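(* For every integer $k\ge 1$, $\chi_{la}(kD(8,2))=3$.
   Context: For a graph $G=(V,E)$ with $|E|=m$ and no isolated vertices, a local antimagic labeling is a bijection $f:E\to\{1,\dots,m\}$ such that $f^+(u)\ne f^+(v)$ for every edge $uv$, where $f^+(x)=\sum f(e)$ over all edges $e$ incident to $x$. The local antimagic chromatic number $\chi_{la}(G)$ is the minimum, over all local antimagic labelings $f$ of $G$, of the number of distinct values taken by $f^+$ (also for disconnected graphs). $kG$ is the disjoint union of $k$ copies of $G$. Let $C_8^*$ be the graph consisting of an 8-cycle $u_1u_2\cdots u_8u_1$ together with an additional vertex $x$ adjacent to $u_2$ and $u_6$. $D(8,2)$ is obtained from $C_8^*$ by merging the three vertices $x$, $u_4$, $u_8$ into a single vertex $w$ (of degree 6). *)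

theory Defs
  imports Main "HOL-Library.Extended_Nat"
begin

text \<open>Finite simple graphs: a vertex set together with a set of two-element subsets of it.\<close>

type_synonym 'a graph = "'a set \<times> 'a set set"

abbreviation verts :: "'a graph \<Rightarrow> 'a set" where "verts \<equiv> fst"
abbreviation edges :: "'a graph \<Rightarrow> 'a set set" where "edges \<equiv> snd"

definition simple_graph :: "'a graph \<Rightarrow> bool" where
  "simple_graph G \<longleftrightarrow> finite (verts G) \<and> (\<forall>e\<in>edges G. e \<subseteq> verts G \<and> card e = 2)"

definition no_isolated_vertices :: "'a graph \<Rightarrow> bool" where
  "no_isolated_vertices G \<longleftrightarrow> (\<forall>v\<in>verts G. \<exists>e\<in>edges G. v \<in> e)"

definition degree :: "'a graph \<Rightarrow> 'a \<Rightarrow> nat" where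
  "degree G v = card {e \<in> edges G. v \<in> e}"

definition induced_label :: "'a graph \<Rightarrow> ('a set \<Rightarrow> nat) \<Rightarrow> 'a \<Rightarrow> nat" where
  "induced_label G f v = (\<Sum>e | e \<in> edges G \<and> v \<in> e. f e)"

definition local_antimagic :: "'a graph \<Rightarrow> ('a set \<Rightarrow> nat) \<Rightarrow> bool" where
  "local_antimagic G f \<longleftrightarrow>
     bij_betw f (edges G) {1..card (edges G)} \<and>
     (\<forall>u v. {u, v} \<in> edges G \<longrightarrow> induced_label G f u \<noteq> induced_label G f v)"

text \<open>The value is taken in \<^typ>\<open>enat\<close> so that a graph without any local antimagic labeling gets
  the value \<open>\<infinity>\<close>; a finite value is therefore attained by some labeling.\<close>

definition chi_la :: "'a graph \<Rightarrow> enat" where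
  "chi_la G = (INF f \<in> {f. local_antimagic G f}. enat (card (induced_label G f ` verts G)))"

definition copies :: "nat \<Rightarrow> 'a graph \<Rightarrow> (nat \<times> 'a) graph" where
  "copies k G = ({..<k} \<times> verts G, {Pair i ` e | i e. i < k \<and> e \<in> edges G})"

text \<open>Merging (identifying) all vertices of \<open>A\<close> into the vertex \<open>w\<close>.  On edge sets this is faithful
  to the usual operation only if no loops or parallel edges arise; \<open>D82_simple\<close> and
  \<open>D82_no_parallel\<close> below show this for the case of interest.\<close>

definition merge_map :: "'a set \<Rightarrow> 'a \<Rightarrow> 'a \<Rightarrow> 'a" where
  "merge_map A w v = (if v \<in> A then w else v)"

definition merge :: "'a set \<Rightarrow> 'a \<Rightarrow> 'a graph \<Rightarrow> 'a graph" where
  "merge A w G = (merge_map A w ` verts G, (\<lambda>e. merge_map A w ` e) ` edges G)"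

datatype vertex = U nat | X | W

definition C8_star :: "vertex graph" where
  "C8_star =
     (insert X (U ` {1..8}),
      (\<lambda>i. {U i, U (i + 1)}) ` {1..7} \<union> {{U 8, U 1}} \<union> {{X, U 2}, {X, U 6}})"

definition D82 :: "vertex graph" where
  "D82 = merge {X, U 4, U 8} W C8_star"

lemma C8_star_edges:
  "edges C8_star = {{U 1, U 2}, {U 2, U 3}, {U 3, U 4}, {U 4, U 5}, {U 5, U 6}, {U 6, U 7},
     {U 7, U 8}, {U 8, U 1}, {X, U 2}, {X, U 6}}"
proof -
  have range: "{1..7::nat} = {1, 2, 3, 4, 5, 6, 7}"
    by auto
  have "edges C8_star = (\<lambda>i. {U i, U (i + 1)}) ` {1, 2, 3, 4, 5, 6, 7} \<union> {{U 8, U 1}}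
      \<union> {{X, U 2}, {X, U 6}}"
    unfolding C8_star_def snd_conv range by (rule refl)
  then show ?thesis
    by (simp del: Un_insert_right add: numeral_2_eq_2[symmetric])
qed

lemma D82_verts: "verts D82 = {W, U 1, U 2, U 3, U 5, U 6, U 7}"
proof -
  have "{1..8::nat} = {1, 2, 3, 4, 5, 6, 7, 8}"
    by auto
  then show ?thesis
    by (auto simp: D82_def merge_def merge_map_def C8_star_def)
qed

lemma D82_edges:
  "edges D82 = {{U 1, U 2}, {U 2, U 3}, {U 3, W}, {W, U 5}, {U 5, U 6}, {U 6, U 7},
     {U 7, W}, {W, U 1}, {W, U 2}, {W, U 6}}"
proof -
  have "edges D82 = (\<lambda>e. merge_map {X, U 4, U 8} W ` e) ` edges C8_star"
    by (simp add: D82_def merge_def)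
  then show ?thesis
    unfolding C8_star_edges by (simp add: merge_map_def insert_commute[of _ W])
qed

lemma D82_simple: "simple_graph D82"
  by (simp add: simple_graph_def D82_verts D82_edges)

lemma D82_no_isolated_vertices: "no_isolated_vertices D82"
  by (simp add: no_isolated_vertices_def D82_verts D82_edges)

lemma D82_no_parallel: "card (edges D82) = card (edges C8_star)"
  by (simp add: D82_edges C8_star_edges doubleton_eq_iff)

lemma D82_size: "card (edges D82) = 10"
  by (simp add: D82_edges doubleton_eq_iff)

lemma D82_degree_W: "degree D82 W = 6"
proof -
  have "{e \<in> edges D82. W \<in> e} = {{U 3, W}, {W, U 5}, {U 7, W}, {W, U 1}, {W, U 2}, {W, U 6}}"
    by (auto simp: D82_edges)
  then show ?thesis
    by (simp add: degree_def doubleton_eq_iff)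
qed

lemma copies_simple: "simple_graph G \<Longrightarrow> simple_graph (copies k G)"
  by (auto simp: simple_graph_def copies_def card_image inj_on_def)

lemma copies_no_isolated_vertices:
  assumes "no_isolated_vertices G"
  shows "no_isolated_vertices (copies k G)"
  unfolding no_isolated_vertices_def
proof
  fix p assume "p \<in> verts (copies k G)"
  then obtain i v where p: "p = (i, v)" "i < k" "v \<in> verts G"
    by (auto simp: copies_def)
  with assms obtain e where "e \<in> edges G" "v \<in> e"
    by (auto simp: no_isolated_vertices_def)
  with p have "Pair i ` e \<in> edges (copies k G)" "p \<in> Pair i ` e"
    by (auto simp: copies_def)
  then show "\<exists>e\<in>edges (copies k G). p \<in> e"
    by blast
qed

end

theory Submission imports Defs begin

text \<open>
  The vertices \<open>w\<close>, \<open>u\<^sub>1\<close>, \<open>u\<^sub>2\<close> form a triangle, so three values are necessary.  For sufficiency, note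
  that \<open>D(8,2)\<close> consists of two copies of \<open>K\<^sub>4 - e\<close> glued at the vertex \<open>w\<close>, which has
  degree 3 in each of them.  The labels \<open>1, \<dots>, 2k\<close> go to the two edges \<open>w u\<^sub>2\<close>, \<open>w u\<^sub>6\<close> of each copy, with sum \<open>2k + 1\<close>, and the
  labels \<open>2k + 1, \<dots>, 10k\<close> are split into pairs with sum \<open>12k + 1\<close>, one for each vertex of degree 2.
  If moreover the labels at \<open>u\<^sub>2\<close> and at \<open>u\<^sub>6\<close> have a common sum \<open>b\<close>, then the sum at \<open>w\<close> is forced to be
  \<open>4(12k + 1) - 2b + 2(2k + 1)\<close>.  Arithmetic progressions with differences \<open>1\<close> and \<open>2\<close> in the index
  of the copy achieve this with \<open>b = 11k + 1\<close>.
\<close>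

lemma verts_copies: "verts (copies k G) = {..<k} \<times> verts G"
  by (simp add: copies_def)

lemma inj_image_Pair: "inj (image (Pair i))"
  by (simp add: inj_on_def inj_image_eq_iff)

text \<open>A nonempty edge remembers the index of its copy, whereas the empty set has the same
  image in every copy.\<close>

lemma Pair_image_eq_iff:
  assumes "e \<noteq> {}"
  shows "Pair i ` e = Pair j ` e' \<longleftrightarrow> i = j \<and> e = e'"
  using assms by auto

lemma card_edges_copies:
  assumes "{} \<notin> edges G"
  shows "card (edges (copies k G)) = k * card (edges G)"
proof -
  have "edges (copies k G) = (\<lambda>(i, e). Pair i ` e) ` ({..<k} \<times> edges G)"
    by (auto simp: copies_def)
  moreover have "inj_on (\<lambda>(i, e). Pair i ` e) ({..<k} \<times> edges G)"
    using assms by (auto intro!: inj_onI dest!: Pair_image_eq_iff[THEN iffD1, rotated])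
  ultimately show ?thesis
    by (simp add: card_image card_cartesian_product)
qed

lemma induced_label_copies:
  assumes "i < k"
  shows "induced_label (copies k G) f (i, v) = induced_label G (\<lambda>e. f (Pair i ` e)) v"
proof -
  have "{e \<in> edges (copies k G). (i, v) \<in> e} = image (Pair i) ` {e \<in> edges G. v \<in> e}"
    using assms by (auto simp: copies_def)
  then show ?thesis
    by (simp add: induced_label_def sum.reindex inj_on_subset[OF inj_image_Pair])
qed

text \<open>The bound is shown for each labeling separately, so it also covers an empty infimum,
  which is \<infinity>.\<close>

lemma chi_la_triangle:
  assumes "finite (verts G)" and "{u, v, w} \<subseteq> verts G"
    and "{u, v} \<in> edges G" "{v, w} \<in> edges G" "{u, w} \<in> edges G"
  shows "3 \<le> chi_la G"
  unfolding chi_la_def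
proof (rule INF_greatest)
  fix f assume "f \<in> {f. local_antimagic G f}"
  then have "card (induced_label G f ` {u, v, w}) = 3"
    using assms(3-5) by (auto simp: local_antimagic_def)
  moreover have "card (induced_label G f ` {u, v, w}) \<le> card (induced_label G f ` verts G)"
    using assms(1,2) by (intro card_mono) auto
  ultimately have "enat 3 \<le> enat (card (induced_label G f ` verts G))"
    by simp
  then show "3 \<le> enat (card (induced_label G f ` verts G))"
    by (simp add: numeral_eq_enat)
qed

text \<open>The final branch is for \<open>{W, U 6}\<close>. For \<open>i < k\<close> no subtraction
  truncates. Six edges each fill a block of \<open>k\<close> consecutive labels; the edges with step
  2 interleave in pairs on two blocks of length \<open>2 * k\<close>.\<close>

definition D82_label :: "nat \<Rightarrow> nat \<Rightarrow> vertex set \<Rightarrow> nat" where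
  "D82_label k i e =
     (if e = {U 1, U 2} then 5 * k - 1 - 2 * i
      else if e = {U 2, U 3} then 5 * k + 1 + i
      else if e = {U 3, W} then 7 * k - i
      else if e = {W, U 1} then 7 * k + 2 + 2 * i
      else if e = {W, U 2} then k + 1 + i
      else if e = {U 5, U 6} then 7 * k + 1 + 2 * i
      else if e = {U 6, U 7} then 3 * k - i
      else if e = {U 7, W} then 9 * k + 1 + i
      else if e = {W, U 5} then 5 * k - 2 * i
      else k - i)"

lemma D82_label_simps:
  "D82_label k i {U 1, U 2} = 5 * k - 1 - 2 * i"
  "D82_label k i {U 2, U 3} = 5 * k + 1 + i"
  "D82_label k i {U 3, W} = 7 * k - i"
  "D82_label k i {W, U 1} = 7 * k + 2 + 2 * i"
  "D82_label k i {W, U 2} = k + 1 + i"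
  "D82_label k i {U 5, U 6} = 7 * k + 1 + 2 * i"
  "D82_label k i {U 6, U 7} = 3 * k - i"
  "D82_label k i {U 7, W} = 9 * k + 1 + i"
  "D82_label k i {W, U 5} = 5 * k - 2 * i"
  "D82_label k i {W, U 6} = k - i"
  by (simp_all add: D82_label_def doubleton_eq_iff)

lemma D82_label_surj:
  assumes "x \<in> {1..10 * k}"
  shows "\<exists>i<k. \<exists>e\<in>edges D82. D82_label k i e = x"
proof -
  have *: ?thesis if "i < k" "e \<in> edges D82" "D82_label k i e = x" for i e
    using that by blast
  consider "x \<le> k" | "k < x" "x \<le> 2 * k" | "2 * k < x" "x \<le> 3 * k"
    | "3 * k < x" "x \<le> 5 * k" | "5 * k < x" "x \<le> 6 * k" | "6 * k < x" "x \<le> 7 * k"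
    | "7 * k < x" "x \<le> 9 * k" | "9 * k < x" "x \<le> 10 * k"
    using assms by force
  then show ?thesis
  proof cases
    case 1
    then show ?thesis
      using assms by (intro *[of "k - x" "{W, U 6}"]) (auto simp: D82_edges D82_label_simps)
  next
    case 2
    then show ?thesis
      by (intro *[of "x - (k + 1)" "{W, U 2}"]) (auto simp: D82_edges D82_label_simps)
  next
    case 3
    then show ?thesis
      by (intro *[of "3 * k - x" "{U 6, U 7}"]) (auto simp: D82_edges D82_label_simps)
  next
    case 4
    \<comment> \<open>The parity of the distance from \<open>5 * k\<close> decides the edge: even
      for \<open>{W, U 5}\<close>, odd for \<open>{U 1, U 2}\<close>.\<close>
    define i where "i = (5 * k - x) div 2"
    have "5 * k - x = 2 * i \<or> 5 * k - x = 2 * i + 1"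
      unfolding i_def by presburger
    then have "i < k" "D82_label k i {W, U 5} = x \<or> D82_label k i {U 1, U 2} = x"
      using 4 unfolding D82_label_simps by linarith+
    then show ?thesis
      using *[of i "{W, U 5}"] *[of i "{U 1, U 2}"] unfolding D82_edges by fast
  next
    case 5
    then show ?thesis
      by (intro *[of "x - (5 * k + 1)" "{U 2, U 3}"]) (auto simp: D82_edges D82_label_simps)
  next
    case 6
    then show ?thesis
      by (intro *[of "7 * k - x" "{U 3, W}"]) (auto simp: D82_edges D82_label_simps)
  next
    case 7
    define i where "i = (x - (7 * k + 1)) div 2"
    have "x - (7 * k + 1) = 2 * i \<or> x - (7 * k + 1) = 2 * i + 1"
      unfolding i_def by presburger
    then have "i < k" "D82_label k i {U 5, U 6} = x \<or> D82_label k i {W, U 1} = x"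
      using 7 unfolding D82_label_simps by linarith+
    then show ?thesis
      using *[of i "{U 5, U 6}"] *[of i "{W, U 1}"] unfolding D82_edges by fast
  next
    case 8
    then show ?thesis
      by (intro *[of "x - (9 * k + 1)" "{U 7, W}"]) (auto simp: D82_edges D82_label_simps)
  qed
qed

lemma D82_label_range:
  assumes "i < k" "e \<in> edges D82"
  shows "D82_label k i e \<in> {1..10 * k}"
  using assms(2,1) unfolding D82_edges
  by (elim insertE emptyE; hypsubst; simp only: D82_label_simps atLeastAtMost_iff; linarith)

lemma induced_label_D82:
  "induced_label D82 f W =
     f {U 3, W} + f {W, U 5} + f {U 7, W} + f {W, U 1} + f {W, U 2} + f {W, U 6}"
  "induced_label D82 f (U 1) = f {U 1, U 2} + f {W, U 1}"
  "induced_label D82 f (U 2) = f {U 1, U 2} + f {U 2, U 3} + f {W, U 2}"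
  "induced_label D82 f (U 3) = f {U 2, U 3} + f {U 3, W}"
  "induced_label D82 f (U 5) = f {W, U 5} + f {U 5, U 6}"
  "induced_label D82 f (U 6) = f {U 5, U 6} + f {U 6, U 7} + f {W, U 6}"
  "induced_label D82 f (U 7) = f {U 6, U 7} + f {U 7, W}"
proof -
  have "finite (edges D82)"
    by (simp add: D82_edges)
  \<comment> \<open>A membership test in the summand lets the sum be evaluated over the explicit
    list of edges.\<close>
  then have *: "induced_label D82 f v = (\<Sum>e\<in>edges D82. if v \<in> e then f e else 0)" for v
    by (simp add: induced_label_def sum.inter_filter)
  show
    "induced_label D82 f W =
       f {U 3, W} + f {W, U 5} + f {U 7, W} + f {W, U 1} + f {W, U 2} + f {W, U 6}"
    "induced_label D82 f (U 1) = f {U 1, U 2} + f {W, U 1}"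
    "induced_label D82 f (U 2) = f {U 1, U 2} + f {U 2, U 3} + f {W, U 2}"
    "induced_label D82 f (U 3) = f {U 2, U 3} + f {U 3, W}"
    "induced_label D82 f (U 5) = f {W, U 5} + f {U 5, U 6}"
    "induced_label D82 f (U 6) = f {U 5, U 6} + f {U 6, U 7} + f {W, U 6}"
    "induced_label D82 f (U 7) = f {U 6, U 7} + f {U 7, W}"
    unfolding * D82_edges by (simp_all add: doubleton_eq_iff)
qed

text \<open>The coefficients of \<open>i\<close> cancel at every vertex, for instance -2 + 1 + 1 at
  \<open>U 2\<close> and 2 - 1 - 1 at \<open>U 6\<close>.\<close>

lemma induced_label_D82_label:
  assumes "i < k" "v \<in> verts D82"
  shows "induced_label D82 (D82_label k i) v =
    (if v = W then 30 * k + 4 else if v \<in> {U 2, U 6} then 11 * k + 1 else 12 * k + 1)"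
  using assms(2,1) unfolding D82_verts
  by (elim insertE emptyE; hypsubst; simp only: induced_label_D82 D82_label_simps; simp)

theorem theorem4p5:
  fixes k :: nat
  assumes "k \<ge> 1"
  shows "chi_la (copies k D82) = 3"
proof (rule antisym)
  let ?G = "copies k D82"
  \<comment> \<open>On an edge of a copy, \<open>fst\<close> takes a single value, the index of the
    copy.\<close>
  define f where "f e = D82_label k (the_elem (fst ` e)) (snd ` e)" for e :: "(nat \<times> vertex) set"
  have nonempty: "{} \<notin> edges D82"
    using D82_simple by (auto simp: simple_graph_def)
  have f_Pair: "f (Pair i ` e) = D82_label k i e" if "e \<in> edges D82" for i e
  proof -
    have "e \<noteq> {}"
      using that nonempty by auto
    then show ?thesis
      by (simp add: f_def image_image image_constant_conv)
  qed
  have induced: "induced_label ?G f (i, v) =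
      (if v = W then 30 * k + 4 else if v \<in> {U 2, U 6} then 11 * k + 1 else 12 * k + 1)"
    if "i < k" "v \<in> verts D82" for i v
  proof -
    have "induced_label ?G f (i, v) = induced_label D82 (D82_label k i) v"
      unfolding induced_label_copies[OF that(1)] by (simp add: induced_label_def f_Pair)
    then show ?thesis
      using induced_label_D82_label[OF that] by simp
  qed
  have card_edges: "card (edges ?G) = 10 * k"
    by (simp add: card_edges_copies[OF nonempty] D82_size)
  have image: "f ` edges ?G = {1..10 * k}"
  proof (rule set_eqI)
    fix x
    have "x \<in> f ` edges ?G \<longleftrightarrow> (\<exists>i<k. \<exists>e\<in>edges D82. f (Pair i ` e) = x)"
      unfolding copies_def by auto
    also have "\<dots> \<longleftrightarrow> (\<exists>i<k. \<exists>e\<in>edges D82. D82_label k i e = x)"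
      by (simp add: f_Pair cong: bex_cong)
    finally have "x \<in> f ` edges ?G \<longleftrightarrow> (\<exists>i<k. \<exists>e\<in>edges D82. D82_label k i e = x)" .
    then show "x \<in> f ` edges ?G \<longleftrightarrow> x \<in> {1..10 * k}"
      using D82_label_surj[of x k] D82_label_range[of _ k] by metis
  qed
  have "finite (edges ?G)"
    using assms by (intro card_ge_0_finite) (simp add: card_edges)
  \<comment> \<open>Injectivity comes from counting: \<open>f\<close> maps \<open>10 * k\<close>
    edges onto \<open>10 * k\<close> labels.\<close>
  then have "inj_on f (edges ?G)"
    by (rule eq_card_imp_inj_on) (simp add: card_edges image)
  then have "bij_betw f (edges ?G) {1..card (edges ?G)}"
    using image card_edges by (simp add: bij_betw_def)
  moreover have "induced_label ?G f p \<noteq> induced_label ?G f q" if pq: "{p, q} \<in> edges ?G" for p q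
  proof -
    obtain i e where ie: "i < k" "e \<in> edges D82" "{p, q} = Pair i ` e"
      using pq by (auto simp: copies_def)
    then have "p \<in> Pair i ` e" "q \<in> Pair i ` e"
      by blast+
    then obtain u v where uv: "p = (i, u)" "q = (i, v)"
      by blast
    have "Pair i ` {u, v} = Pair i ` e"
      using ie(3) uv by simp
    then have "{u, v} \<in> edges D82"
      using ie(2) inj_image_Pair by (metis injD)
    \<comment> \<open>The classes \<open>{W}\<close>, \<open>{U 2, U 6}\<close> and the four
      remaining vertices are independent sets; their values differ since
      \<open>k \<ge> 1\<close>.\<close>
    then have "u \<in> verts D82" "v \<in> verts D82"
      "(u = W) \<noteq> (v = W) \<or> (u \<in> {U 2, U 6}) \<noteq> (v \<in> {U 2, U 6})"
      using D82_simple unfolding simple_graph_def by (auto simp: D82_edges doubleton_eq_iff)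
    then show ?thesis
      using assms ie(1) by (auto simp: uv induced split: if_splits)
  qed
  ultimately have "local_antimagic ?G f"
    by (simp add: local_antimagic_def)
  then have "chi_la ?G \<le> enat (card (induced_label ?G f ` verts ?G))"
    unfolding chi_la_def by (intro INF_lower) simp
  also have "\<dots> \<le> 3"
  proof -
    have "induced_label ?G f ` verts ?G \<subseteq> {30 * k + 4, 11 * k + 1, 12 * k + 1}"
      by (auto simp: verts_copies induced)
    then have "card (induced_label ?G f ` verts ?G) \<le> card {30 * k + 4, 11 * k + 1, 12 * k + 1}"
      by (intro card_mono) auto
    then show ?thesis
      using assms by (simp add: numeral_eq_enat)
  qed
  finally show "chi_la ?G \<le> 3" .

  \<comment> \<open>Copy 0 exists because \<open>k \<ge> 1\<close>, and it supplies the
    triangle.\<close>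
  have "Pair 0 ` e \<in> edges ?G" if "e \<in> edges D82" for e
    using assms that unfolding copies_def by fastforce
  from this[of "{W, U 1}"] this[of "{U 1, U 2}"] this[of "{W, U 2}"]
  show "3 \<le> chi_la ?G"
    using assms by (intro chi_la_triangle[of _ "(0, W)" "(0, U 1)" "(0, U 2)"])
      (auto simp: verts_copies D82_edges D82_verts)
qed

end
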